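(* Let $L_2=\langle a,t \mid a^2,\ [t^{i}at^{-i},t^{j}at^{-j}],\ i,j\in\mathbb{Z}\rangle$. The full language of geodesics for $L_2$ with respect to the generating set $\{t,ta\}$ is accepted by a 1-counter automaton.
   Context: $L_2$ is the lamplighter group, i.e. the wreath product $\mathbb{Z}_2\wr\mathbb{Z}$, where $a$ generates $\mathbb{Z}_2$ and $t$ generates $\mathbb{Z}$; in the generating set $\{t,ta\}$ the element $ta$ is treated as a single letter. For a group $G$ with finite generating set $X$, words are finite strings over the alphabet $X\cup X^{-1}$; a word is geodesic if its length equals the word length (with respect to $X$) of the element it represents. The full language of geodesics is the set of all geodesic words. For a group $H$ and a finite alphabet $A$, a (non-deterministic) $H$-automaton over $A$ is a finite directed graph with a distinguished start vertex, some distinguished accept vertices, and edges labelled by elements of $(A\cup\{\epsilon\})\times H$, where $\epsilon$ is the empty string. For a path $p$, $w(p)$ is the word obtained by concatenating the first components of its edge labels and $g(p)\in H$ is the product of the second components (the empty path gives the empty word and the identity). The automaton accepts a word $w$ if there is a path $p$ from the start vertex to an accept vertex with $w(p)=w$ and $g(p)=1$ in $H$. A 1-counter automaton is a $\mathbb{Z}$-automaton. *)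

theory Defs
  imports "HOL-Algebra.Elementary_Groups"
begin

section \<open>Groups given by generators and relators\<close>

text \<open>In a formal word over the generators, the pair \<open>(x, True)\<close> stands for the generator
  \<open>x\<close> and \<open>(x, False)\<close> for its formal inverse.\<close>

type_synonym 'x fword = "('x \<times> bool) list"

definition fword_gen :: "'x \<Rightarrow> 'x fword" where
  "fword_gen x = [(x, True)]"

definition fword_inv :: "'x fword \<Rightarrow> 'x fword" where
  "fword_inv u = rev (map (\<lambda>(x, b). (x, \<not> b)) u)"

definition fword_pow :: "'x fword \<Rightarrow> int \<Rightarrow> 'x fword" where
  "fword_pow u i = concat (replicate (nat \<bar>i\<bar>) (if i \<ge> 0 then u else fword_inv u))"

definition fword_commutator :: "'x fword \<Rightarrow> 'x fword \<Rightarrow> 'x fword" where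
  "fword_commutator u v = u @ v @ fword_inv u @ fword_inv v"

text \<open>The congruence \<open>pres_eq R\<close> is generated by free cancellation and by the relators in
  \<open>R\<close>, so its classes are the elements of the free group on \<open>UNIV :: 'x set\<close> modulo the
  normal closure of \<open>R\<close>.\<close>

inductive pres_eq :: "'x fword set \<Rightarrow> 'x fword \<Rightarrow> 'x fword \<Rightarrow> bool"
  for R :: "'x fword set" where
  refl: "pres_eq R u u"
| sym: "pres_eq R u v \<Longrightarrow> pres_eq R v u"
| trans: "pres_eq R u v \<Longrightarrow> pres_eq R v w \<Longrightarrow> pres_eq R u w"
| cancel: "pres_eq R (u @ [(x, b), (x, \<not> b)] @ v) (u @ v)"
| relator: "r \<in> R \<Longrightarrow> pres_eq R (u @ r @ v) (u @ v)"

definition pres_class :: "'x fword set \<Rightarrow> 'x fword \<Rightarrow> 'x fword set" where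
  "pres_class R u = {v. pres_eq R u v}"

definition presented_group :: "'x fword set \<Rightarrow> 'x fword set monoid" where
  "presented_group R =
     \<lparr>carrier = range (pres_class R),
      monoid.mult = (\<lambda>A B. {w. \<exists>u\<in>A. \<exists>v\<in>B. pres_eq R (u @ v) w}),
      one = pres_class R []\<rparr>"

lemma pres_eq_append_context: "pres_eq R u v \<Longrightarrow> pres_eq R (p @ u @ q) (p @ v @ q)"
proof (induction rule: pres_eq.induct)
  case (cancel u x b v)
  show ?case using pres_eq.cancel[of R "p @ u" x b "v @ q"] by simp
next
  case (relator r u v)
  then show ?case using pres_eq.relator[of r R "p @ u" "v @ q"] by simp
qed (blast intro: pres_eq.refl pres_eq.sym pres_eq.trans)+

lemma pres_eq_append:
  assumes "pres_eq R u u'" "pres_eq R v v'"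
  shows "pres_eq R (u @ v) (u' @ v')"
  using pres_eq_append_context[OF assms(1), of "[]" v]
        pres_eq_append_context[OF assms(2), of u' "[]"]
  by (simp add: pres_eq.trans)

lemma pres_class_eq_iff: "pres_class R u = pres_class R v \<longleftrightarrow> pres_eq R u v"
  unfolding pres_class_def by (blast intro: pres_eq.refl pres_eq.sym pres_eq.trans)

lemma pres_class_mult:
  "pres_class R u \<otimes>\<^bsub>presented_group R\<^esub> pres_class R v = pres_class R (u @ v)"
proof -
  have "(\<exists>u'\<in>pres_class R u. \<exists>v'\<in>pres_class R v. pres_eq R (u' @ v') w) \<longleftrightarrow> pres_eq R (u @ v) w" for w
    unfolding pres_class_def by (blast intro: pres_eq.trans pres_eq_append pres_eq.refl)
  then show ?thesis by (simp add: presented_group_def pres_class_def)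
qed

lemma pres_class_in_carrier: "pres_class R u \<in> carrier (presented_group R)"
  by (simp add: presented_group_def)

lemma presented_group_one: "\<one>\<^bsub>presented_group R\<^esub> = pres_class R []"
  by (simp add: presented_group_def)

lemma pres_eq_inv_left: "pres_eq R (fword_inv u @ u) []"
proof (induction u)
  case (Cons l u)
  obtain x b where l: "l = (x, b)" by fastforce
  have "pres_eq R (fword_inv u @ [(x, \<not> b), (x, \<not> \<not> b)] @ u) (fword_inv u @ u)"
    by (rule pres_eq.cancel)
  with Cons show ?case
    by (simp add: l fword_inv_def) (rule pres_eq.trans)
qed (simp add: fword_inv_def pres_eq.refl)

theorem group_presented_group: "group (presented_group R)"
proof (rule groupI)
  fix x assume "x \<in> carrier (presented_group R)"
  then obtain u where "x = pres_class R u" by (auto simp: presented_group_def)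
  then have "pres_class R (fword_inv u) \<otimes>\<^bsub>presented_group R\<^esub> x = \<one>\<^bsub>presented_group R\<^esub>"
    by (simp add: pres_class_mult presented_group_one pres_class_eq_iff pres_eq_inv_left)
  then show "\<exists>y\<in>carrier (presented_group R). y \<otimes>\<^bsub>presented_group R\<^esub> x = \<one>\<^bsub>presented_group R\<^esub>"
    using pres_class_in_carrier by blast
next
  fix x y assume "x \<in> carrier (presented_group R)" "y \<in> carrier (presented_group R)"
  then obtain u v where "x = pres_class R u" "y = pres_class R v"
    by (auto simp: presented_group_def)
  then show "x \<otimes>\<^bsub>presented_group R\<^esub> y \<in> carrier (presented_group R)"
    by (simp add: pres_class_mult pres_class_in_carrier)
next
  fix x y z
  assume "x \<in> carrier (presented_group R)" "y \<in> carrier (presented_group R)"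
    "z \<in> carrier (presented_group R)"
  then obtain u v w where "x = pres_class R u" "y = pres_class R v" "z = pres_class R w"
    by (auto simp: presented_group_def)
  then show "x \<otimes>\<^bsub>presented_group R\<^esub> y \<otimes>\<^bsub>presented_group R\<^esub> z =
      x \<otimes>\<^bsub>presented_group R\<^esub> (y \<otimes>\<^bsub>presented_group R\<^esub> z)"
    by (simp add: pres_class_mult)
next
  fix x assume "x \<in> carrier (presented_group R)"
  then obtain u where "x = pres_class R u" by (auto simp: presented_group_def)
  then show "\<one>\<^bsub>presented_group R\<^esub> \<otimes>\<^bsub>presented_group R\<^esub> x = x"
    by (simp add: presented_group_one pres_class_mult)
qed (simp add: presented_group_one pres_class_in_carrier)


section \<open>The lamplighter group\<close>

datatype lamp_gen = Gen_a | Gen_t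

definition lamp_conj :: "int \<Rightarrow> lamp_gen fword" where
  "lamp_conj i = fword_pow (fword_gen Gen_t) i @ fword_gen Gen_a @ fword_pow (fword_gen Gen_t) (- i)"

definition lamplighter_relators :: "lamp_gen fword set" where
  "lamplighter_relators =
     insert (fword_pow (fword_gen Gen_a) 2)
       {fword_commutator (lamp_conj i) (lamp_conj j) | i j. True}"

definition lamplighter_group :: "lamp_gen fword set monoid" ("L\<^sub>2") where
  "L\<^sub>2 = presented_group lamplighter_relators"

definition lamp_a :: "lamp_gen fword set" where
  "lamp_a = pres_class lamplighter_relators (fword_gen Gen_a)"

definition lamp_t :: "lamp_gen fword set" where
  "lamp_t = pres_class lamplighter_relators (fword_gen Gen_t)"

definition lamp_gens :: "lamp_gen fword set set" where
  "lamp_gens = {lamp_t, lamp_t \<otimes>\<^bsub>L\<^sub>2\<^esub> lamp_a}"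

lemma group_lamplighter: "group L\<^sub>2"
  by (simp add: lamplighter_group_def group_presented_group)

lemma lamp_a_carrier: "lamp_a \<in> carrier L\<^sub>2" and lamp_t_carrier: "lamp_t \<in> carrier L\<^sub>2"
  by (simp_all add: lamp_a_def lamp_t_def lamplighter_group_def pres_class_in_carrier)

lemma lamp_gens_generate: "generate L\<^sub>2 lamp_gens = carrier L\<^sub>2"
proof
  interpret group L\<^sub>2 by (rule group_lamplighter)
  let ?c = "pres_class lamplighter_relators"
  have gens: "lamp_gens \<subseteq> carrier L\<^sub>2"
    by (simp add: lamp_gens_def lamp_a_carrier lamp_t_carrier)
  show "generate L\<^sub>2 lamp_gens \<subseteq> carrier L\<^sub>2"
    by (rule generate_incl[OF gens])
  have inv: "inv\<^bsub>L\<^sub>2\<^esub> g \<in> generate L\<^sub>2 lamp_gens" if "g \<in> generate L\<^sub>2 lamp_gens" for g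
    by (rule generate_m_inv_closed[OF gens that])
  have t: "lamp_t \<in> generate L\<^sub>2 lamp_gens"
    by (rule generate.incl) (simp add: lamp_gens_def)
  have "lamp_t \<otimes>\<^bsub>L\<^sub>2\<^esub> lamp_a \<in> generate L\<^sub>2 lamp_gens"
    by (rule generate.incl) (simp add: lamp_gens_def)
  from generate.eng[OF inv[OF t] this] have a: "lamp_a \<in> generate L\<^sub>2 lamp_gens"
    using lamp_a_carrier lamp_t_carrier by (simp flip: m_assoc)
  have pos: "?c [(x, True)] \<in> generate L\<^sub>2 lamp_gens" for x
    using a t by (cases x) (simp_all add: lamp_a_def lamp_t_def fword_gen_def)
  have "?c [(x, False)] = inv\<^bsub>L\<^sub>2\<^esub> ?c [(x, True)]" for x
    using pres_eq_inv_left[of lamplighter_relators "[(x, True)]"]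
    by (intro inv_equality[symmetric])
       (simp_all add: lamplighter_group_def pres_class_mult presented_group_one
          pres_class_eq_iff fword_inv_def pres_class_in_carrier)
  then have letter: "?c [(x, b)] \<in> generate L\<^sub>2 lamp_gens" for x b
    using pos inv by (cases b) simp_all
  have "?c u \<in> generate L\<^sub>2 lamp_gens" for u
  proof (induction u)
    case Nil
    show ?case
      using generate.one[of "L\<^sub>2" lamp_gens] by (simp add: lamplighter_group_def presented_group_one)
  next
    case (Cons l u)
    have "?c (l # u) = ?c [(fst l, snd l)] \<otimes>\<^bsub>L\<^sub>2\<^esub> ?c u"
      by (simp add: lamplighter_group_def pres_class_mult)
    also have "\<dots> \<in> generate L\<^sub>2 lamp_gens" by (rule generate.eng[OF letter Cons])
    finally show ?case .
  qed
  then show "carrier L\<^sub>2 \<subseteq> generate L\<^sub>2 lamp_gens"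
    by (auto simp: lamplighter_group_def presented_group_def)
qed


section \<open>Geodesic words\<close>

text \<open>Letters are group elements, so a word over \<open>X \<union> X\<^sup>-\<^sup>1\<close> is a list of group elements.\<close>

definition letters :: "('g, 'm) monoid_scheme \<Rightarrow> 'g set \<Rightarrow> 'g set" where
  "letters G X = X \<union> m_inv G ` X"

definition word_value :: "('g, 'm) monoid_scheme \<Rightarrow> 'g list \<Rightarrow> 'g" where
  "word_value G w = foldr (monoid.mult G) w \<one>\<^bsub>G\<^esub>"

definition word_length :: "('g, 'm) monoid_scheme \<Rightarrow> 'g set \<Rightarrow> 'g \<Rightarrow> nat" where
  "word_length G X g = (LEAST n. \<exists>w\<in>lists (letters G X). word_value G w = g \<and> length w = n)"

definition geodesics :: "('g, 'm) monoid_scheme \<Rightarrow> 'g set \<Rightarrow> 'g list set" where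
  "geodesics G X = {w \<in> lists (letters G X). length w = word_length G X (word_value G w)}"


section \<open>Automata over a group\<close>

text \<open>An edge is a tuple of its source, its letter (\<open>None\<close> for the empty string), its group
  element and its target; two parallel edges with equal labels would accept the same words as one.\<close>

type_synonym ('v, 'a, 'h) edge = "'v \<times> 'a option \<times> 'h \<times> 'v"

record ('v, 'a, 'h) automaton =
  vertices :: "'v set"
  edges :: "('v, 'a, 'h) edge set"
  start :: 'v
  accepting :: "'v set"

definition group_automaton ::
    "('h, 'm) monoid_scheme \<Rightarrow> 'a set \<Rightarrow> ('v, 'a, 'h) automaton \<Rightarrow> bool" where
  "group_automaton H A M \<longleftrightarrow>
     group H \<and> finite A \<and>
     finite (vertices M) \<and> finite (edges M) \<and>
     edges M \<subseteq> vertices M \<times> insert None (Some ` A) \<times> carrier H \<times> vertices M \<and>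
     start M \<in> vertices M \<and> accepting M \<subseteq> vertices M"

fun is_path ::
    "('v, 'a, 'h) automaton \<Rightarrow> 'v \<Rightarrow> ('v, 'a, 'h) edge list \<Rightarrow> 'v \<Rightarrow> bool" where
  "is_path M p [] q \<longleftrightarrow> p \<in> vertices M \<and> p = q"
| "is_path M p (e # es) q \<longleftrightarrow>
     e \<in> edges M \<and> fst e = p \<and> is_path M (snd (snd (snd e))) es q"

definition path_word :: "('v, 'a, 'h) edge list \<Rightarrow> 'a list" where
  "path_word es = concat (map (\<lambda>(p, l, h, q). case l of None \<Rightarrow> [] | Some x \<Rightarrow> [x]) es)"

definition path_value :: "('h, 'm) monoid_scheme \<Rightarrow> ('v, 'a, 'h) edge list \<Rightarrow> 'h" where
  "path_value H es = word_value H (map (\<lambda>(p, l, h, q). h) es)"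

definition accepted_language ::
    "('h, 'm) monoid_scheme \<Rightarrow> ('v, 'a, 'h) automaton \<Rightarrow> 'a list set" where
  "accepted_language H M =
     {w. \<exists>es. \<exists>q\<in>accepting M.
        is_path M (start M) es q \<and> path_word es = w \<and> path_value H es = \<one>\<^bsub>H\<^esub>}"

text \<open>Vertices may be taken to be natural numbers, since a vertex set is finite.\<close>

definition accepted_by_one_counter :: "'a set \<Rightarrow> 'a list set \<Rightarrow> bool" where
  "accepted_by_one_counter A L \<longleftrightarrow>
     (\<exists>M :: (nat, 'a, int) automaton.
        group_automaton integer_group A M \<and> accepted_language integer_group M = L)"

end

theory Submission
  imports Defs "HOL-Library.Countable"
begin

text \<open>Each letter moves the lamplighter along one edge of the line and may switch the lamp on that
  edge. A walk from \<open>0\<close> to \<open>p\<close> therefore has to cross every edge between \<open>0\<close> and \<open>p\<close> an odd number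
  of times and every edge beyond, up to the extreme lamps that are on, at least twice. A word is
  geodesic iff these bounds are attained: the walk first goes away from \<open>p\<close> to the extreme lamp on
  that side, then straight to the extreme lamp on the other side, and back to \<open>p\<close>; and at each turn,
  where the same edge is crossed twice in succession, exactly one of the two crossings switches the
  lamp, as otherwise that edge need not have been visited. For words of the shape
  \<open>L\<^sup>i R\<^sup>j L\<^sup>k\<close> the position \<open>p\<close> lies on the right iff \<open>i + k \<le> j\<close>, which one counter can check.\<close>

section \<open>Word values and presented groups\<close>

lemma word_value_Nil [simp]: "word_value G [] = \<one>\<^bsub>G\<^esub>"
  and word_value_Cons [simp]: "word_value G (x # w) = x \<otimes>\<^bsub>G\<^esub> word_value G w"
  by (simp_all add: word_value_def)

lemma (in monoid) word_value_closed: "set w \<subseteq> carrier G \<Longrightarrow> word_value G w \<in> carrier G"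
  by (induction w) auto

lemma (in monoid) word_value_append:
  "set u \<subseteq> carrier G \<Longrightarrow> set v \<subseteq> carrier G \<Longrightarrow>
    word_value G (u @ v) = word_value G u \<otimes> word_value G v"
  by (induction u) (auto simp: word_value_closed m_assoc)

lemma (in monoid) word_value_commute:
  assumes "x \<in> carrier G" "set w \<subseteq> carrier G" "\<And>y. y \<in> set w \<Longrightarrow> x \<otimes> y = y \<otimes> x"
  shows "x \<otimes> word_value G w = word_value G w \<otimes> x"
  using assms
proof (induction w)
  case (Cons y w)
  have y: "y \<in> carrier G" and w: "word_value G w \<in> carrier G"
    using Cons.prems by (auto intro: word_value_closed)
  have "x \<otimes> (y \<otimes> word_value G w) = y \<otimes> (x \<otimes> word_value G w)"
    using Cons.prems(1,3) y w by (simp flip: m_assoc)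
  also have "\<dots> = y \<otimes> (word_value G w \<otimes> x)"
    using Cons by simp
  finally show ?case using Cons.prems(1) y w by (simp add: m_assoc)
qed simp

lemma (in group) inv_mult_cancel_left:
  "x \<in> carrier G \<Longrightarrow> y \<in> carrier G \<Longrightarrow> inv x \<otimes> (x \<otimes> y) = y"
  by (simp flip: m_assoc)

text \<open>By parity the first letter occurs again later in the list. Commutation moves it up to
  that occurrence, where the two cancel; all counts stay even and the list gets shorter.\<close>

lemma (in monoid) word_value_commuting_involutions:
  assumes c: "\<And>i. c i \<in> carrier G"
    and comm: "\<And>i j. c i \<otimes> c j = c j \<otimes> c i"
    and invol: "\<And>i. c i \<otimes> c i = \<one>"
    and even: "\<And>i. even (count_list l i)"
  shows "word_value G (map c l) = \<one>"
  using even
proof (induction l rule: length_induct)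
  case (1 l)
  show ?case
  proof (cases l)
    case (Cons i l')
    have cl: "set (map c k) \<subseteq> carrier G" for k
      using c by auto
    have "odd (count_list l' i)"
      using 1(2)[rule_format, of i] Cons by simp
    then have "i \<in> set l'"
      by (metis count_notin even_zero)
    then obtain k m where l': "l' = k @ i # m"
      by (meson split_list)
    have "even (count_list (k @ m) j)" for j
      using 1(2)[rule_format, of j] by (auto simp: Cons l' split: if_splits)
    then have IH: "word_value G (map c (k @ m)) = \<one>"
      using 1(1)[rule_format, of "k @ m"] by (simp add: Cons l')
    let ?K = "word_value G (map c k)" and ?M = "word_value G (map c m)"
    have KM: "?K \<in> carrier G" "?M \<in> carrier G"
      using cl by (blast intro: word_value_closed)+
    have "word_value G (map c l) = c i \<otimes> (?K \<otimes> (c i \<otimes> ?M))"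
      using word_value_append[OF cl cl, of k "i # m"] by (simp add: Cons l')
    also have "\<dots> = (c i \<otimes> ?K) \<otimes> (c i \<otimes> ?M)"
      using c KM by (simp add: m_assoc)
    also have "c i \<otimes> ?K = ?K \<otimes> c i"
      using c comm cl[of k] by (intro word_value_commute) auto
    also have "?K \<otimes> c i \<otimes> (c i \<otimes> ?M) = ?K \<otimes> ((c i \<otimes> c i) \<otimes> ?M)"
      using c KM by (simp add: m_assoc)
    also have "\<dots> = word_value G (map c (k @ m))"
      using KM by (simp add: invol word_value_append[OF cl cl, simplified])
    finally show ?thesis using IH by simp
  qed simp
qed

section \<open>Inverses and powers in presented groups\<close>

lemma pres_class_fword_inv: "pres_class R (fword_inv u) = inv\<^bsub>presented_group R\<^esub> pres_class R u"
proof -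
  interpret group "presented_group R" by (rule group_presented_group)
  show ?thesis
    by (rule inv_equality[symmetric])
      (simp_all add: pres_class_mult pres_class_in_carrier presented_group_one
        pres_class_eq_iff pres_eq_inv_left)
qed

lemma pres_class_fword_pow:
  "pres_class R (fword_pow u i) = pres_class R u [^]\<^bsub>presented_group R\<^esub> i"
proof -
  interpret group "presented_group R" by (rule group_presented_group)
  have nat_pow: "pres_class R (concat (replicate n v)) = pres_class R v [^]\<^bsub>presented_group R\<^esub> n" for n v
  proof (induction n)
    case 0
    show ?case by (simp add: presented_group_one)
  next
    case (Suc n)
    have "pres_class R (concat (replicate (Suc n) v)) =
        pres_class R v \<otimes>\<^bsub>presented_group R\<^esub> pres_class R (concat (replicate n v))"
      by (simp add: pres_class_mult)
    then show ?case
      unfolding Suc nat_pow_Suc2[OF pres_class_in_carrier] .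
  qed
  show ?thesis
  proof (cases "i < 0")
    case True
    then have "fword_pow u i = concat (replicate (nat (- i)) (fword_inv u))"
      by (simp add: fword_pow_def)
    then show ?thesis
      using True unfolding int_pow_def2
      by (simp only: nat_pow pres_class_fword_inv nat_pow_inv[OF pres_class_in_carrier] if_True)
  next
    case False
    then have "fword_pow u i = concat (replicate (nat i) u)"
      by (simp add: fword_pow_def)
    then show ?thesis
      using False unfolding int_pow_def2 by (simp only: nat_pow if_False)
  qed
qed

section \<open>The word problem of the lamplighter group\<close>

fun shift :: "lamp_gen fword \<Rightarrow> int" where
  "shift [] = 0"
| "shift ((Gen_a, b) # u) = shift u"
| "shift ((Gen_t, b) # u) = (if b then 1 else - 1) + shift u"

text \<open>The letter \<open>a\<close>, read at position \<open>p\<close>, contributes the conjugate \<open>t\<^sup>p a t\<^sup>-\<^sup>p\<close> to the word.\<close>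

fun toggled :: "int \<Rightarrow> lamp_gen fword \<Rightarrow> int list" where
  "toggled p [] = []"
| "toggled p ((Gen_a, b) # u) = p # toggled p u"
| "toggled p ((Gen_t, b) # u) = toggled (p + (if b then 1 else - 1)) u"

lemma shift_append [simp]: "shift (u @ v) = shift u + shift v"
  by (induction u rule: shift.induct) auto

lemma toggled_append [simp]: "toggled p (u @ v) = toggled p u @ toggled (p + shift u) v"
  by (induction p u rule: toggled.induct) (auto simp: add.assoc)

lemma shift_fword_inv [simp]: "shift (fword_inv u) = - shift u"
  by (induction u rule: shift.induct) (auto simp: fword_inv_def)

text \<open>The inverse word retraces the walk backwards. To end at \<open>p\<close>, the walk of
  \<open>u\<close> has to start at \<open>p - shift u\<close>.\<close>

lemma toggled_fword_inv: "toggled p (fword_inv u) = rev (toggled (p - shift u) u)"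
proof (induction "p - shift u" u arbitrary: p rule: toggled.induct)
  case (2 b u)
  have "fword_inv ((Gen_a, b) # u) = fword_inv u @ [(Gen_a, \<not> b)]"
    by (simp add: fword_inv_def)
  then show ?case using 2[of p] by simp
next
  case (3 b u)
  have "fword_inv ((Gen_t, b) # u) = fword_inv u @ [(Gen_t, \<not> b)]"
    by (simp add: fword_inv_def)
  then show ?case using 3[of p] by (simp add: algebra_simps)
qed (simp add: fword_inv_def)

lemma shift_t_pow [simp]: "shift (fword_pow (fword_gen Gen_t) i) = i"
proof -
  have "shift (concat (replicate n [(Gen_t, b)])) = (if b then int n else - int n)" for n b
    by (induction n) auto
  then show ?thesis by (auto simp: fword_pow_def fword_gen_def fword_inv_def)
qed

lemma toggled_t_pow [simp]: "toggled p (fword_pow (fword_gen Gen_t) i) = []"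
proof -
  have "toggled p (concat (replicate n [(Gen_t, b)])) = []" for n b
    by (induction n arbitrary: p) auto
  then show ?thesis by (auto simp: fword_pow_def fword_gen_def fword_inv_def)
qed

lemma shift_lamp_conj [simp]: "shift (lamp_conj i) = 0"
  by (simp add: lamp_conj_def) (simp add: fword_gen_def)

lemma toggled_lamp_conj [simp]: "toggled p (lamp_conj i) = [p + i]"
  by (simp add: lamp_conj_def) (simp add: fword_gen_def)

lemma lamplighter_relator_trivial:
  assumes "r \<in> lamplighter_relators"
  shows "shift r = 0" "even (count_list (toggled p r) e)"
proof -
  from assms consider "r = fword_pow (fword_gen Gen_a) 2"
    | i j where "r = fword_commutator (lamp_conj i) (lamp_conj j)"
    unfolding lamplighter_relators_def by blast
  then have "shift r = 0 \<and> even (count_list (toggled p r) e)"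
  proof cases
    case 1
    then have "r = [(Gen_a, True), (Gen_a, True)]"
      by (simp add: fword_pow_def fword_gen_def numeral_2_eq_2)
    then show ?thesis by simp
  next
    case 2
    then show ?thesis by (simp add: fword_commutator_def toggled_fword_inv)
  qed
  then show "shift r = 0" "even (count_list (toggled p r) e)" by auto
qed

text \<open>Soundness half of the word problem: inserting a relator or a cancelling pair moves no
  later letter, since its \<open>shift\<close> is 0, and changes the count of each lamp by an even
  number.\<close>

lemma lamplighter_pres_eq_invariant:
  assumes "pres_eq lamplighter_relators u v"
  shows "shift u = shift v \<and> (\<forall>p e. even (count_list (toggled p u) e) = even (count_list (toggled p v) e))"
  using assms
proof (induction rule: pres_eq.induct)
  case (cancel u x b v)
  show ?case by (cases x) auto
next
  case (relator r u v)
  then show ?case using lamplighter_relator_trivial by auto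
qed auto

section \<open>Normal forms in the lamplighter group\<close>

context
begin

interpretation L: group "L\<^sub>2" by (rule group_lamplighter)

private definition lamp :: "int \<Rightarrow> lamp_gen fword set" where
  "lamp i = lamp_t [^]\<^bsub>L\<^sub>2\<^esub> i \<otimes>\<^bsub>L\<^sub>2\<^esub> lamp_a \<otimes>\<^bsub>L\<^sub>2\<^esub> lamp_t [^]\<^bsub>L\<^sub>2\<^esub> (- i)"

private lemma pres_class_lamp_conj: "pres_class lamplighter_relators (lamp_conj i) = lamp i"
  unfolding lamp_def lamp_conj_def lamplighter_group_def lamp_t_def lamp_a_def
    pres_class_fword_pow[symmetric] pres_class_mult by simp

private lemma pres_class_lamplighter_relator:
  assumes "r \<in> lamplighter_relators"
  shows "pres_class lamplighter_relators r = \<one>\<^bsub>L\<^sub>2\<^esub>"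
  using pres_eq.relator[OF assms, of "[]" "[]"]
  by (simp add: lamplighter_group_def presented_group_one pres_class_eq_iff)

private lemma lamp_a_square: "lamp_a \<otimes>\<^bsub>L\<^sub>2\<^esub> lamp_a = \<one>\<^bsub>L\<^sub>2\<^esub>"
  using pres_class_lamplighter_relator[of "fword_pow (fword_gen Gen_a) 2"]
  by (simp add: lamplighter_relators_def lamplighter_group_def lamp_a_def pres_class_mult
      fword_pow_def numeral_2_eq_2)

private lemma lamp_closed: "lamp i \<in> carrier L\<^sub>2"
  by (simp add: lamp_def lamp_a_carrier lamp_t_carrier)

private lemma lamp_square: "lamp i \<otimes>\<^bsub>L\<^sub>2\<^esub> lamp i = \<one>\<^bsub>L\<^sub>2\<^esub>"
proof -
  let ?t = "lamp_t [^]\<^bsub>L\<^sub>2\<^esub> i"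
  have t: "?t \<in> carrier L\<^sub>2" by (simp add: lamp_t_carrier)
  have "lamp i \<otimes>\<^bsub>L\<^sub>2\<^esub> lamp i =
      ?t \<otimes>\<^bsub>L\<^sub>2\<^esub> (lamp_a \<otimes>\<^bsub>L\<^sub>2\<^esub> (inv\<^bsub>L\<^sub>2\<^esub> ?t \<otimes>\<^bsub>L\<^sub>2\<^esub> ?t) \<otimes>\<^bsub>L\<^sub>2\<^esub> lamp_a) \<otimes>\<^bsub>L\<^sub>2\<^esub> inv\<^bsub>L\<^sub>2\<^esub> ?t"
    using t lamp_a_carrier lamp_t_carrier
    by (simp add: lamp_def L.int_pow_neg L.m_assoc L.inv_mult_cancel_left)
  then show ?thesis
    using t lamp_a_carrier by (simp add: lamp_a_square)
qed

private lemma lamp_commute: "lamp i \<otimes>\<^bsub>L\<^sub>2\<^esub> lamp j = lamp j \<otimes>\<^bsub>L\<^sub>2\<^esub> lamp i"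
proof -
  have "lamp i \<otimes>\<^bsub>L\<^sub>2\<^esub> lamp j \<otimes>\<^bsub>L\<^sub>2\<^esub> (inv\<^bsub>L\<^sub>2\<^esub> lamp i \<otimes>\<^bsub>L\<^sub>2\<^esub> inv\<^bsub>L\<^sub>2\<^esub> lamp j) = \<one>\<^bsub>L\<^sub>2\<^esub>"
  proof -
    have "pres_class lamplighter_relators (fword_commutator (lamp_conj i) (lamp_conj j)) = \<one>\<^bsub>L\<^sub>2\<^esub>"
      by (rule pres_class_lamplighter_relator) (auto simp: lamplighter_relators_def)
    then have "lamp i \<otimes>\<^bsub>L\<^sub>2\<^esub> (lamp j \<otimes>\<^bsub>L\<^sub>2\<^esub> (inv\<^bsub>L\<^sub>2\<^esub> lamp i \<otimes>\<^bsub>L\<^sub>2\<^esub> inv\<^bsub>L\<^sub>2\<^esub> lamp j)) = \<one>\<^bsub>L\<^sub>2\<^esub>"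
      unfolding fword_commutator_def lamplighter_group_def pres_class_lamp_conj[symmetric]
        pres_class_fword_inv[symmetric] pres_class_mult .
    then show ?thesis
      using lamp_closed by (simp add: L.m_assoc)
  qed
  then have "lamp i \<otimes>\<^bsub>L\<^sub>2\<^esub> lamp j \<otimes>\<^bsub>L\<^sub>2\<^esub> inv\<^bsub>L\<^sub>2\<^esub> (lamp j \<otimes>\<^bsub>L\<^sub>2\<^esub> lamp i) = \<one>\<^bsub>L\<^sub>2\<^esub>"
    using lamp_closed by (simp add: L.inv_mult_group)
  then show ?thesis
    using lamp_closed L.inv_solve_right[of "\<one>\<^bsub>L\<^sub>2\<^esub>" "lamp i \<otimes>\<^bsub>L\<^sub>2\<^esub> lamp j" "lamp j \<otimes>\<^bsub>L\<^sub>2\<^esub> lamp i"]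
    by simp
qed

private lemma pres_class_a: "pres_class lamplighter_relators [(Gen_a, b)] = lamp_a"
proof (cases b)
  case False
  have "pres_class lamplighter_relators [(Gen_a, False)] = inv\<^bsub>L\<^sub>2\<^esub> lamp_a"
    using pres_class_fword_inv[of lamplighter_relators "fword_gen Gen_a"]
    by (simp add: fword_inv_def fword_gen_def lamp_a_def lamplighter_group_def)
  also have "\<dots> = lamp_a"
    using lamp_a_square lamp_a_carrier by (simp add: L.inv_equality)
  finally show ?thesis using False by simp
qed (simp add: lamp_a_def fword_gen_def)

private lemma pres_class_t:
  "pres_class lamplighter_relators [(Gen_t, b)] = lamp_t [^]\<^bsub>L\<^sub>2\<^esub> (if b then 1 else - 1 :: int)"
  using pres_class_fword_inv[of lamplighter_relators "fword_gen Gen_t"]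
  by (cases b)
    (simp_all add: fword_inv_def fword_gen_def lamp_t_def lamplighter_group_def
      group.int_pow_neg[OF group_presented_group] group.int_pow_1[OF group_presented_group]
      pres_class_in_carrier)

text \<open>The power of \<open>lamp_t\<close> is pushed to the right through \<open>u\<close>: it
  passes an \<open>a\<close> by leaving \<open>lamp p\<close> behind, and it absorbs each
  \<open>t\<close>. With \<open>p = 0\<close> this writes an element as a product of lamps times a
  power of \<open>lamp_t\<close>.\<close>

private lemma pres_class_normal_form:
  "lamp_t [^]\<^bsub>L\<^sub>2\<^esub> p \<otimes>\<^bsub>L\<^sub>2\<^esub> pres_class lamplighter_relators u =
    word_value L\<^sub>2 (map lamp (toggled p u)) \<otimes>\<^bsub>L\<^sub>2\<^esub> lamp_t [^]\<^bsub>L\<^sub>2\<^esub> (p + shift u)"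
proof (induction p u rule: toggled.induct)
  case (1 p)
  show ?case
    using lamp_t_carrier
    by (simp add: presented_group_one[of lamplighter_relators, folded lamplighter_group_def, symmetric])
next
  case (2 p b u)
  let ?t = "lamp_t [^]\<^bsub>L\<^sub>2\<^esub> p" and ?u = "pres_class lamplighter_relators u"
  have t: "?t \<in> carrier L\<^sub>2" and u: "?u \<in> carrier L\<^sub>2"
    by (simp_all add: lamp_t_carrier lamplighter_group_def pres_class_in_carrier
        group.int_pow_closed[OF group_presented_group] lamp_t_def)
  have w: "word_value L\<^sub>2 (map lamp (toggled p u)) \<in> carrier L\<^sub>2"
    using lamp_closed by (intro L.word_value_closed) auto
  have "pres_class lamplighter_relators ((Gen_a, b) # u) = lamp_a \<otimes>\<^bsub>L\<^sub>2\<^esub> ?u"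
    using pres_class_mult[of lamplighter_relators "[(Gen_a, b)]" u]
    by (simp add: pres_class_a lamplighter_group_def)
  moreover have "lamp p \<otimes>\<^bsub>L\<^sub>2\<^esub> (?t \<otimes>\<^bsub>L\<^sub>2\<^esub> ?u) =
      ?t \<otimes>\<^bsub>L\<^sub>2\<^esub> lamp_a \<otimes>\<^bsub>L\<^sub>2\<^esub> (inv\<^bsub>L\<^sub>2\<^esub> ?t \<otimes>\<^bsub>L\<^sub>2\<^esub> ?t) \<otimes>\<^bsub>L\<^sub>2\<^esub> ?u"
    using t u lamp_a_carrier lamp_t_carrier
    by (simp add: lamp_def L.int_pow_neg L.m_assoc L.inv_mult_cancel_left)
  ultimately have "?t \<otimes>\<^bsub>L\<^sub>2\<^esub> pres_class lamplighter_relators ((Gen_a, b) # u) =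
      lamp p \<otimes>\<^bsub>L\<^sub>2\<^esub> (?t \<otimes>\<^bsub>L\<^sub>2\<^esub> ?u)"
    using t u lamp_a_carrier by (simp add: L.m_assoc)
  then show ?case
    using 2 w lamp_closed lamp_t_carrier by (simp add: L.m_assoc)
next
  case (3 p b u)
  let ?u = "pres_class lamplighter_relators u" and ?s = "if b then 1 else - 1 :: int"
  have u: "?u \<in> carrier L\<^sub>2"
    by (simp add: lamplighter_group_def pres_class_in_carrier)
  have "pres_class lamplighter_relators ((Gen_t, b) # u) = lamp_t [^]\<^bsub>L\<^sub>2\<^esub> ?s \<otimes>\<^bsub>L\<^sub>2\<^esub> ?u"
    using pres_class_mult[of lamplighter_relators "[(Gen_t, b)]" u]
    by (simp add: pres_class_t lamplighter_group_def)
  then have "lamp_t [^]\<^bsub>L\<^sub>2\<^esub> p \<otimes>\<^bsub>L\<^sub>2\<^esub> pres_class lamplighter_relators ((Gen_t, b) # u) =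
      lamp_t [^]\<^bsub>L\<^sub>2\<^esub> (p + ?s) \<otimes>\<^bsub>L\<^sub>2\<^esub> ?u"
    using u lamp_t_carrier by (simp add: L.int_pow_mult L.m_assoc)
  then show ?case
    using 3 by (simp add: add.assoc)
qed

private lemma pres_class_eq_oneI:
  assumes "shift u = 0" "\<And>e. even (count_list (toggled 0 u) e)"
  shows "pres_class lamplighter_relators u = \<one>\<^bsub>L\<^sub>2\<^esub>"
proof -
  have u: "pres_class lamplighter_relators u \<in> carrier L\<^sub>2"
    by (simp add: lamplighter_group_def pres_class_in_carrier)
  have "word_value L\<^sub>2 (map lamp (toggled 0 u)) = \<one>\<^bsub>L\<^sub>2\<^esub>"
    by (intro L.word_value_commuting_involutions lamp_closed lamp_commute lamp_square assms)
  then show ?thesis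
    using pres_class_normal_form[of 0 u] u assms(1) by simp
qed

text \<open>Completeness half of the word problem. As the shifts agree, the inverse of
  \<open>v\<close> toggles after \<open>u\<close> the same lamps as \<open>v\<close> does from 0, so
  \<open>u @ fword_inv v\<close> toggles each lamp evenly often and is trivial.\<close>

lemma lamplighter_pres_class_eqI:
  assumes "shift u = shift v"
    and "\<And>e. even (count_list (toggled 0 u) e) = even (count_list (toggled 0 v) e)"
  shows "pres_class lamplighter_relators u = pres_class lamplighter_relators v"
proof -
  have closed: "pres_class lamplighter_relators w \<in> carrier L\<^sub>2" for w
    by (simp add: lamplighter_group_def pres_class_in_carrier)
  have "pres_class lamplighter_relators (u @ fword_inv v) = \<one>\<^bsub>L\<^sub>2\<^esub>"
    using assms by (intro pres_class_eq_oneI) (simp_all add: toggled_fword_inv)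
  then have "pres_class lamplighter_relators u \<otimes>\<^bsub>L\<^sub>2\<^esub> inv\<^bsub>L\<^sub>2\<^esub> pres_class lamplighter_relators v = \<one>\<^bsub>L\<^sub>2\<^esub>"
    by (simp add: lamplighter_group_def pres_class_mult flip: pres_class_fword_inv)
  then show ?thesis
    using closed[of u] closed[of v] L.inv_solve_right[of "\<one>\<^bsub>L\<^sub>2\<^esub>"
      "pres_class lamplighter_relators u" "pres_class lamplighter_relators v"]
    by simp
qed

end

section \<open>Words over the generators as walks on the line\<close>

text \<open>A move \<open>(d, b)\<close> crosses an edge of the line, to the right iff \<open>d\<close>, and switches the lamp on
  that edge iff \<open>b\<close>; the edge between \<open>e - 1\<close> and \<open>e\<close> carries the lamp \<open>e\<close>. This makes
  \<open>ta\<close> and its inverse \<open>at\<^sup>-\<^sup>1\<close> the two switching moves.\<close>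

type_synonym move = "bool \<times> bool"

fun displacement :: "move list \<Rightarrow> int" where
  "displacement [] = 0"
| "displacement ((d, b) # w) = (if d then 1 else - 1) + displacement w"

text \<open>Inequality of booleans is addition modulo 2, so this is the parity of the switches of
  lamp \<open>e\<close> by a walk from \<open>p\<close>. A right move from \<open>p\<close> crosses
  edge \<open>p + 1\<close>, a left move crosses edge \<open>p\<close>.\<close>

fun lit :: "int \<Rightarrow> move list \<Rightarrow> int \<Rightarrow> bool" where
  "lit p [] e \<longleftrightarrow> False"
| "lit p ((d, b) # w) e \<longleftrightarrow>
     (b \<and> e = (if d then p + 1 else p)) \<noteq> lit (p + (if d then 1 else - 1)) w e"

lemma displacement_append [simp]: "displacement (u @ v) = displacement u + displacement v"
  by (induction u rule: displacement.induct) auto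

lemma lit_append [simp]: "lit p (u @ v) e \<longleftrightarrow> lit p u e \<noteq> lit (p + displacement u) v e"
  by (induction p u e rule: lit.induct) (auto simp: add.assoc)

definition move_fword :: "move \<Rightarrow> lamp_gen fword" where
  "move_fword m =
     (let u = (Gen_t, True) # (if snd m then [(Gen_a, True)] else [])
      in if fst m then u else fword_inv u)"

definition move_elem :: "move \<Rightarrow> lamp_gen fword set" where
  "move_elem m = pres_class lamplighter_relators (move_fword m)"

definition lamp_equiv :: "move list \<Rightarrow> move list \<Rightarrow> bool" where
  "lamp_equiv u v \<longleftrightarrow> displacement u = displacement v \<and> (\<forall>p. lit p u = lit p v)"

lemma shift_move_fwords: "shift (concat (map move_fword w)) = displacement w"
  by (induction w rule: displacement.induct) (simp_all add: move_fword_def fword_inv_def)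

lemma toggled_move_fwords:
  "even (count_list (toggled p (concat (map move_fword w))) e) \<longleftrightarrow> \<not> lit p w e"
  by (induction p w e rule: lit.induct) (auto simp: move_fword_def fword_inv_def)

lemma letters_lamp_gens: "letters L\<^sub>2 lamp_gens = range move_elem"
proof -
  have t: "move_elem (True, False) = lamp_t" and ta: "move_elem (True, True) = lamp_t \<otimes>\<^bsub>L\<^sub>2\<^esub> lamp_a"
    by (simp_all add: move_elem_def move_fword_def lamp_t_def lamp_a_def fword_gen_def
        lamplighter_group_def pres_class_mult)
  have inv: "move_elem (False, b) = inv\<^bsub>L\<^sub>2\<^esub> move_elem (True, b)" for b
    by (simp add: move_elem_def move_fword_def lamplighter_group_def pres_class_fword_inv)
  have "range move_elem = {move_elem (True, False), move_elem (True, True),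
      move_elem (False, False), move_elem (False, True)}"
    by (simp add: UNIV_bool insert_commute flip: UNIV_Times_UNIV)
  then show ?thesis
    by (simp add: letters_def lamp_gens_def inv t ta insert_commute)
qed

lemma word_value_move_elems:
  "word_value L\<^sub>2 (map move_elem w) = pres_class lamplighter_relators (concat (map move_fword w))"
  by (induction w)
    (simp_all add: move_elem_def lamplighter_group_def presented_group_one pres_class_mult)

lemma word_value_move_elems_eq_iff:
  "word_value L\<^sub>2 (map move_elem u) = word_value L\<^sub>2 (map move_elem v) \<longleftrightarrow> lamp_equiv u v"
proof
  assume "word_value L\<^sub>2 (map move_elem u) = word_value L\<^sub>2 (map move_elem v)"
  then show "lamp_equiv u v"
    using lamplighter_pres_eq_invariant[of "concat (map move_fword u)" "concat (map move_fword v)"]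
    by (auto simp: word_value_move_elems pres_class_eq_iff shift_move_fwords toggled_move_fwords
        lamp_equiv_def)
next
  assume "lamp_equiv u v"
  then show "word_value L\<^sub>2 (map move_elem u) = word_value L\<^sub>2 (map move_elem v)"
    unfolding word_value_move_elems
    by (intro lamplighter_pres_class_eqI)
      (simp_all add: shift_move_fwords toggled_move_fwords lamp_equiv_def)
qed

text \<open>Every word over the letters is the image of a move list, so it suffices to compare
  \<open>w\<close> with the move lists equivalent to it.\<close>

lemma map_move_elem_geodesic_iff:
  "map move_elem w \<in> geodesics L\<^sub>2 lamp_gens \<longleftrightarrow> (\<forall>v. lamp_equiv w v \<longrightarrow> length w \<le> length v)"
proof -
  let ?P = "\<lambda>n. \<exists>u\<in>lists (letters L\<^sub>2 lamp_gens).
    word_value L\<^sub>2 u = word_value L\<^sub>2 (map move_elem w) \<and> length u = n"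
  have P: "?P n \<longleftrightarrow> (\<exists>v. lamp_equiv w v \<and> length v = n)" for n
    unfolding letters_lamp_gens lists_image word_value_move_elems_eq_iff[symmetric]
    by (simp add: eq_commute[of "word_value L\<^sub>2 (map move_elem w)"])
  have "map move_elem w \<in> geodesics L\<^sub>2 lamp_gens \<longleftrightarrow> length w = (LEAST n. ?P n)"
    by (auto simp: geodesics_def word_length_def letters_lamp_gens)
  also have "\<dots> \<longleftrightarrow> (\<forall>v. lamp_equiv w v \<longrightarrow> length w \<le> length v)"
    unfolding P
  proof
    assume "length w = (LEAST n. \<exists>v. lamp_equiv w v \<and> length v = n)"
    then show "\<forall>v. lamp_equiv w v \<longrightarrow> length w \<le> length v"
      by (auto intro: Least_le)
  next
    assume "\<forall>v. lamp_equiv w v \<longrightarrow> length w \<le> length v"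
    then show "length w = (LEAST n. \<exists>v. lamp_equiv w v \<and> length v = n)"
      by (intro Least_equality[symmetric]) (auto simp: lamp_equiv_def)
  qed
  finally show ?thesis .
qed

section \<open>Shortening words that are not tours\<close>

definition switching_turns :: "move list \<Rightarrow> bool" where
  "switching_turns = successively (\<lambda>x y. fst x \<noteq> fst y \<longrightarrow> snd x \<noteq> snd y)"

text \<open>The inequality says that the walk ends at \<open>0\<close> or on the side \<open>d\<close> of \<open>0\<close>. A tour without
  displacement fits both values of \<open>d\<close> if \<open>xs\<close> or \<open>zs\<close> is empty.\<close>

definition tours :: "move list set" where
  "tours = {w. switching_turns w \<and> (\<exists>d xs ys zs. w = xs @ ys @ zs \<and>
     fst ` set xs \<subseteq> {\<not> d} \<and> fst ` set ys \<subseteq> {d} \<and> fst ` set zs \<subseteq> {\<not> d} \<and>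
     length xs + length zs \<le> length ys)}"

lemma toursI:
  assumes "switching_turns (xs @ ys @ zs)"
    and "fst ` set xs \<subseteq> {\<not> d}" "fst ` set ys \<subseteq> {d}" "fst ` set zs \<subseteq> {\<not> d}"
    and "length xs + length zs \<le> length ys"
  shows "xs @ ys @ zs \<in> tours"
  using assms unfolding tours_def by blast

lemma toursE:
  assumes "w \<in> tours"
  obtains d xs ys zs where "w = xs @ ys @ zs" "switching_turns w"
    "fst ` set xs \<subseteq> {\<not> d}" "fst ` set ys \<subseteq> {d}" "fst ` set zs \<subseteq> {\<not> d}"
    "length xs + length zs \<le> length ys"
  using assms unfolding tours_def mem_Collect_eq by (elim conjE exE) (rule that)

lemma lamp_equiv_refl [simp]: "lamp_equiv w w"
  by (simp add: lamp_equiv_def)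

lemma lamp_equiv_append: "lamp_equiv u v \<Longrightarrow> lamp_equiv (u @ w) (v @ w)"
  by (auto simp: lamp_equiv_def fun_eq_iff)

lemma displacement_block:
  "fst ` set w \<subseteq> {d} \<Longrightarrow> displacement w = (if d then 1 else - 1) * int (length w)"
  by (induction w rule: displacement.induct) auto

text \<open>Both moves cross the same edge with the same switching bit, so the switches cancel. This
  removes any turn that violates \<open>switching_turns\<close>.\<close>

lemma lamp_equiv_cancel: "lamp_equiv (u @ [(d, b), (\<not> d, b)]) u"
  by (auto simp: lamp_equiv_def fun_eq_iff)

text \<open>The loops \<open>v\<close> and \<open>v'\<close> are based at the two ends of the edge that is crossed three times, so both
  can be inserted into a walk that crosses it once.\<close>

lemma lamp_equiv_triple_crossing:
  assumes "displacement v = 0" "displacement v' = 0"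
  shows "lamp_equiv (u @ (d, a) # v @ (\<not> d, b) # v' @ [(d, c)]) (u @ v' @ (d, a \<noteq> (b \<noteq> c)) # v)"
  using assms by (auto simp: lamp_equiv_def fun_eq_iff)

text \<open>A shortening of a prefix shortens the whole word, so only a tour followed by one move
  \<open>m\<close> matters. Either \<open>m\<close> makes a bad turn, which cancels, or the word is
  a tour again, or \<open>m\<close> crosses some edge for the third time and two crossings can be
  saved.\<close>

lemma shorten_non_tour: "w \<notin> tours \<Longrightarrow> \<exists>v. lamp_equiv w v \<and> length v < length w"
proof (induction w rule: rev_induct)
  case Nil
  then show ?case using toursI[of "[]" "[]" "[]"] by (simp add: switching_turns_def)
next
  case (snoc m w)
  show ?case
  proof (cases "w \<in> tours")
    case False
    with snoc.IH obtain v where "lamp_equiv w v" "length v < length w" by blast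
    then show ?thesis by (intro exI[of _ "v @ [m]"]) (simp add: lamp_equiv_append)
  next
    case True
    then obtain d xs ys zs where w: "w = xs @ ys @ zs" and turns: "switching_turns w"
      and dirs: "fst ` set xs \<subseteq> {\<not> d}" "fst ` set ys \<subseteq> {d}" "fst ` set zs \<subseteq> {\<not> d}"
      and len: "length xs + length zs \<le> length ys"
      by (rule toursE)
    show ?thesis
    proof (cases "switching_turns (w @ [m])")
      case False
      with turns obtain u x where u: "w = u @ [x]" and "fst x = (\<not> fst m)" "snd x = snd m"
        by (cases w rule: rev_cases) (auto simp: switching_turns_def successively_append_iff)
      then have "w @ [m] = u @ [(fst x, snd x), (\<not> fst x, snd x)]"
        by (simp add: prod_eq_iff)
      then show ?thesis
        using lamp_equiv_cancel[of u "fst x" "snd x"] by (intro exI[of _ u]) simp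
    next
      case turns': True
      show ?thesis
      proof (cases "fst m = d")
        case m: True
        show ?thesis
        proof (cases zs rule: rev_cases)
          case Nil
          have "xs @ (ys @ [m]) @ [] \<in> tours"
            using turns' dirs len m by (intro toursI[where d = d]) (auto simp: w Nil)
          then show ?thesis using snoc.prems by (simp add: w Nil)
        next
          case (snoc zs' z)
          \<comment> \<open>The moves \<open>z\<close> and \<open>m\<close> cross the same edge. The
            middle part crossed it with the move \<open>y\<close> that is followed in
            \<open>ys\<close> by exactly \<open>length zs'\<close> moves.\<close>
          define ys1 ys2 where "ys1 = take (length ys - Suc (length zs')) ys"
            and "ys2 = drop (length ys - Suc (length zs')) ys"
          have ys: "ys = ys1 @ ys2" and "length ys2 = Suc (length zs')"
            using len by (simp_all add: ys1_def ys2_def snoc)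
          then obtain y ys3 where ys2: "ys2 = y # ys3" and len3: "length ys3 = length zs'"
            by (auto simp: length_Suc_conv)
          have "fst ` set ys3 \<subseteq> {d}" "fst ` set zs' \<subseteq> {\<not> d}"
            using dirs(2,3) by (simp_all add: ys ys2 snoc image_Un)
          then have "displacement (ys3 @ zs') = 0"
            by (simp add: displacement_block len3)
          then have "lamp_equiv ((xs @ ys1) @ (d, snd y) # (ys3 @ zs') @ (\<not> d, snd z) # [] @ [(d, snd m)])
              ((xs @ ys1) @ [] @ (d, snd y \<noteq> (snd z \<noteq> snd m)) # (ys3 @ zs'))"
            by (intro lamp_equiv_triple_crossing) simp_all
          moreover have "y = (d, snd y)" "z = (\<not> d, snd z)" "m = (d, snd m)"
            using dirs m by (auto simp: ys ys2 snoc prod_eq_iff)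
          ultimately have "lamp_equiv (w @ [m])
              (xs @ ys1 @ (d, snd y \<noteq> (snd z \<noteq> snd m)) # ys3 @ zs')"
            by (simp add: w ys ys2 snoc)
          then show ?thesis
            by (intro exI conjI) (assumption, simp add: w ys ys2 snoc)
        qed
      next
        case m: False
        show ?thesis
        proof (cases "length xs + length zs < length ys")
          case True
          have "xs @ ys @ (zs @ [m]) \<in> tours"
            using turns' dirs True m by (intro toursI[where d = d]) (auto simp: w)
          then show ?thesis using snoc.prems by (simp add: w)
        next
          case False
          show ?thesis
          proof (cases xs)
            case Nil
            \<comment> \<open>The walk has returned to 0, so \<open>m\<close> takes it to the other
              side: the direction is reversed, \<open>ys\<close> becomes the first part and
              \<open>zs\<close> with \<open>m\<close> the middle part.\<close>
            have "ys @ (zs @ [m]) @ [] \<in> tours"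
              using turns' dirs len False m by (intro toursI[where d = "\<not> d"]) (auto simp: w Nil)
            then show ?thesis using snoc.prems by (simp add: w Nil)
          next
            case (Cons x xs')
            \<comment> \<open>Here too the walk is back at 0, so \<open>m\<close> crosses the edge
              of the very first move \<open>x\<close>. The middle part crosses it after undoing
              \<open>xs'\<close>, that is, after \<open>length xs'\<close> moves.\<close>
            define ys1 ys2 where "ys1 = take (length xs') ys" and "ys2 = drop (length xs') ys"
            have ys: "ys = ys1 @ ys2" and len1: "length ys1 = length xs'"
              and "length ys2 = Suc (length zs)"
              using len False by (simp_all add: ys1_def ys2_def Cons)
            then obtain y ys3 where ys2: "ys2 = y # ys3" and len3: "length ys3 = length zs"
              by (auto simp: length_Suc_conv)
            have "fst ` set xs' \<subseteq> {\<not> d}"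
              using dirs(1) by (simp add: Cons)
            moreover have "fst ` set ys1 \<subseteq> {d}" "fst ` set ys3 \<subseteq> {d}"
              using dirs(2) by (simp_all add: ys ys2 image_Un)
            ultimately have "displacement (xs' @ ys1) = 0" "displacement (ys3 @ zs) = 0"
              using dirs(3) by (simp_all add: displacement_block len1 len3)
            then have "lamp_equiv ([] @ (\<not> d, snd x) # (xs' @ ys1) @ (\<not> \<not> d, snd y) # (ys3 @ zs) @ [(\<not> d, snd m)])
                ([] @ (ys3 @ zs) @ (\<not> d, snd x \<noteq> (snd y \<noteq> snd m)) # (xs' @ ys1))"
              by (rule lamp_equiv_triple_crossing)
            moreover have "x = (\<not> d, snd x)" "y = (d, snd y)" "m = (\<not> d, snd m)"
              using dirs m by (auto simp: ys ys2 Cons prod_eq_iff)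
            ultimately have "lamp_equiv (w @ [m])
                (ys3 @ zs @ (\<not> d, snd x \<noteq> (snd y \<noteq> snd m)) # xs' @ ys1)"
              by (simp add: w ys ys2 Cons)
            then show ?thesis
              by (intro exI conjI) (assumption, simp add: w ys ys2 Cons)
          qed
        qed
      qed
    qed
  qed
qed

section \<open>The length of a tour is determined by its element\<close>

text \<open>A walk from \<open>0\<close> to \<open>p\<close> has to leave the interval between \<open>0\<close> and \<open>p\<close> by \<open>l\<close> to the left and
  by \<open>r\<close> to the right in order to reach the extreme lamps that are on.\<close>

definition lamp_extent :: "(int \<Rightarrow> bool) \<Rightarrow> int \<Rightarrow> nat \<Rightarrow> nat \<Rightarrow> bool" where
  "lamp_extent f p l r \<longleftrightarrow>
     (\<forall>e \<le> min 0 p - int l. \<not> f e) \<and> (l > 0 \<longrightarrow> f (min 0 p - int l + 1)) \<and>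
     (\<forall>e > max 0 p + int r. \<not> f e) \<and> (r > 0 \<longrightarrow> f (max 0 p + int r))"

text \<open>If two values differed, the larger one would require a lamp to be on where the smaller
  one requires it to be off.\<close>

lemma lamp_extent_unique:
  assumes "lamp_extent f p l r" "lamp_extent f p l' r'"
  shows "l = l'" "r = r'"
proof -
  have "\<not> l < l' \<and> \<not> r < r'" if "lamp_extent f p l r" "lamp_extent f p l' r'" for l r l' r'
  proof -
    have "\<not> f (min 0 p - int l' + 1)" if "l < l'"
      using that \<open>lamp_extent f p l r\<close> by (auto simp: lamp_extent_def)
    moreover have "\<not> f (max 0 p + int r')" if "r < r'"
      using that \<open>lamp_extent f p l r\<close> by (auto simp: lamp_extent_def)
    ultimately show ?thesis
      using \<open>lamp_extent f p l' r'\<close> by (auto simp: lamp_extent_def)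
  qed
  from this[OF assms] this[OF assms(2,1)] show "l = l'" "r = r'"
    by auto
qed

lemma lit_right_block:
  "fst ` set w \<subseteq> {True} \<Longrightarrow> lit p w e \<Longrightarrow> p < e \<and> e \<le> p + int (length w)"
proof (induction p w e rule: lit.induct)
  case (2 p d b w e)
  then show ?case by (cases "lit (p + 1) w e") auto
qed auto

lemma lit_left_block:
  "fst ` set w \<subseteq> {False} \<Longrightarrow> lit p w e \<Longrightarrow> p - int (length w) < e \<and> e \<le> p"
proof (induction p w e rule: lit.induct)
  case (2 p d b w e)
  then show ?case by (cases "lit (p - 1) w e") auto
qed auto

text \<open>The walk crosses no edge outside the range from \<open>1 - i\<close> to
  \<open>j - i\<close>. If \<open>i > 0\<close>, the edge \<open>1 - i\<close> is crossed only by
  the two moves of the first turn, one of which switches, so its lamp is on; likewise for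
  \<open>j - i\<close> at the second turn if \<open>k > 0\<close>.\<close>

lemma right_tour_extent:
  assumes turns: "switching_turns (xs @ ys @ zs)"
    and dirs: "fst ` set xs \<subseteq> {False}" "fst ` set ys \<subseteq> {True}" "fst ` set zs \<subseteq> {False}"
    and len: "length xs + length zs \<le> length ys"
  shows "lamp_extent (lit 0 (xs @ ys @ zs)) (displacement (xs @ ys @ zs)) (length xs) (length zs)"
    and "int (length (xs @ ys @ zs)) =
      \<bar>displacement (xs @ ys @ zs)\<bar> + 2 * (int (length xs) + int (length zs))"
proof -
  define i j k where "i = int (length xs)" and "j = int (length ys)" and "k = int (length zs)"
  note ijk = i_def j_def k_def
  have disp: "displacement xs = - i" "displacement ys = j" "displacement zs = - k"
    using dirs displacement_block[of xs False] displacement_block[of ys True]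
      displacement_block[of zs False] by (auto simp: ijk)
  have ge: "0 \<le> i" "0 \<le> k" "i + k \<le> j"
    using len by (auto simp: ijk)
  have lit: "lit 0 (xs @ ys @ zs) e \<longleftrightarrow> lit 0 xs e \<noteq> (lit (- i) ys e \<noteq> lit (j - i) zs e)" for e
    by (simp add: disp)
  have xs: "- i < e \<and> e \<le> 0" if "lit 0 xs e" for e
    using lit_left_block[OF dirs(1) that] by (simp add: ijk)
  have ys: "- i < e \<and> e \<le> j - i" if "lit (- i) ys e" for e
    using lit_right_block[OF dirs(2) that] by (simp add: ijk)
  have zs: "j - i - k < e \<and> e \<le> j - i" if "lit (j - i) zs e" for e
    using lit_left_block[OF dirs(3) that] by (simp add: ijk)
  have left: "lit 0 (xs @ ys @ zs) (1 - i)" if pos: "i > 0"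
  proof -
    obtain xs' x where xs': "xs = xs' @ [x]"
      using pos by (cases xs rule: rev_cases) (auto simp: ijk)
    obtain y ys' where ys': "ys = y # ys'"
      using pos ge by (cases ys) (simp_all add: j_def)
    have "\<not> lit 0 xs' (1 - i)"
      using lit_left_block[of xs' 0 "1 - i"] dirs by (auto simp: xs' ijk)
    moreover have "displacement xs' = 1 - i"
      using disp(1) dirs(1) by (cases x) (auto simp: xs')
    ultimately have "lit 0 xs (1 - i) = snd x"
      using dirs(1) by (cases x) (auto simp: xs')
    moreover have "lit (- i) ys (1 - i) = snd y"
      using dirs(2) lit_right_block[of ys' "1 - i" "1 - i"] by (cases y) (auto simp: ys')
    moreover have "snd x \<noteq> snd y"
      using turns dirs by (auto simp: switching_turns_def xs' ys' successively_append_iff)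
    \<comment> \<open>The last part only crosses edges above \<open>j - i - k\<close>, which is at
      least 0, whereas \<open>1 - i\<close> is at most 0.\<close>
    moreover have "\<not> lit (j - i) zs (1 - i)"
      using zs[of "1 - i"] ge pos by auto
    ultimately show ?thesis unfolding lit by simp
  qed
  have right: "lit 0 (xs @ ys @ zs) (j - i)" if pos: "k > 0"
  proof -
    obtain ys' y where ys': "ys = ys' @ [y]"
      using pos ge by (cases ys rule: rev_cases) (simp_all add: j_def)
    obtain z zs' where zs': "zs = z # zs'"
      using pos by (cases zs) (auto simp: ijk)
    have "\<not> lit (- i) ys' (j - i)"
      using lit_right_block[of ys' "- i" "j - i"] dirs by (auto simp: ys' ijk)
    moreover have "displacement ys' = j - 1"
      using disp(2) dirs(2) by (cases y) (auto simp: ys')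
    ultimately have "lit (- i) ys (j - i) = snd y"
      using dirs(2) by (cases y) (auto simp: ys')
    moreover have "lit (j - i) zs (j - i) = snd z"
      using dirs(3) lit_left_block[of zs' "j - i - 1" "j - i"] by (cases z) (auto simp: zs')
    moreover have "snd y \<noteq> snd z"
      using turns dirs by (auto simp: switching_turns_def ys' zs' successively_append_iff)
    moreover have "\<not> lit 0 xs (j - i)"
      using xs[of "j - i"] ge pos by auto
    ultimately show ?thesis unfolding lit by simp
  qed
  have "\<not> lit 0 (xs @ ys @ zs) e" if "e \<le> - i \<or> e > j - i" for e
    using that xs[of e] ys[of e] zs[of e] ge unfolding lit by auto
  moreover have nonempty: "xs \<noteq> [] \<longleftrightarrow> i > 0" "zs \<noteq> [] \<longleftrightarrow> k > 0"
    by (simp_all add: ijk)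
  ultimately show "lamp_extent (lit 0 (xs @ ys @ zs)) (displacement (xs @ ys @ zs)) (length xs) (length zs)"
    using left right ge nonempty by (auto simp: lamp_extent_def disp simp flip: ijk simp del: lit_append)
  show "int (length (xs @ ys @ zs)) =
      \<bar>displacement (xs @ ys @ zs)\<bar> + 2 * (int (length xs) + int (length zs))"
    using ge by (simp add: disp flip: ijk)
qed

section \<open>Reflection of the line\<close>

lemma displacement_mirror: "displacement (map (apfst Not) w) = - displacement w"
  by (induction w rule: displacement.induct) auto

text \<open>Reflection in 0 maps the edge between \<open>e - 1\<close> and \<open>e\<close> to the
  one between \<open>- e\<close> and \<open>1 - e\<close>, whose lamp is
  \<open>1 - e\<close>.\<close>

lemma lit_mirror: "lit p (map (apfst Not) w) e = lit (- p) w (1 - e)"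
proof (induction w arbitrary: p)
  case (Cons m w)
  obtain d b where m: "m = (d, b)" by fastforce
  have "lit (p + 1) (map (apfst Not) w) e = lit (- p + - 1) w (1 - e)"
    using Cons[of "p + 1"] unfolding minus_add_distrib .
  moreover have "lit (p + - 1) (map (apfst Not) w) e = lit (- p + 1) w (1 - e)"
    using Cons[of "p + - 1"] unfolding minus_add_distrib minus_minus .
  ultimately show ?case
    by (cases d) (auto simp: m)
qed simp

lemma lamp_extent_mirror:
  assumes "lamp_extent (\<lambda>e. f (1 - e)) (- p) l r"
  shows "lamp_extent f p r l"
proof -
  have "max 0 (- p) = - min 0 p" "min 0 (- p) = - max 0 p" by auto
  note A = assms[unfolded lamp_extent_def this]
  have "\<not> f e" if "e \<le> min 0 p - int r" for e
  proof -
    have "1 - e > - min 0 p + int r" using that by simp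
    with A have "\<not> f (1 - (1 - e))" by blast
    then show ?thesis by simp
  qed
  moreover have "\<not> f e" if "e > max 0 p + int l" for e
  proof -
    have "1 - e \<le> - max 0 p - int l" using that by simp
    with A have "\<not> f (1 - (1 - e))" by blast
    then show ?thesis by simp
  qed
  ultimately show ?thesis
    using A by (auto simp: lamp_extent_def algebra_simps)
qed

lemma switching_turns_mirror: "switching_turns (map (apfst Not) w) = switching_turns w"
  by (simp add: switching_turns_def successively_map)

text \<open>A tour with middle part to the left is the mirror image of one to the right. The formula
  expresses the length through data of the group element alone.\<close>

lemma tour_extent:
  assumes "w \<in> tours"
  shows "\<exists>l r. lamp_extent (lit 0 w) (displacement w) l r \<and>
    int (length w) = \<bar>displacement w\<bar> + 2 * (int l + int r)"
proof -
  obtain d xs ys zs where w: "w = xs @ ys @ zs" and turns: "switching_turns w"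
    and dirs: "fst ` set xs \<subseteq> {\<not> d}" "fst ` set ys \<subseteq> {d}" "fst ` set zs \<subseteq> {\<not> d}"
    and len: "length xs + length zs \<le> length ys"
    using assms by (rule toursE)
  show ?thesis
  proof (cases d)
    case True
    with right_tour_extent[of xs ys zs] turns dirs len show ?thesis by (auto simp: w)
  next
    case False
    let ?m = "map (apfst Not) :: move list \<Rightarrow> _"
    have "lamp_extent (lit 0 (?m w)) (displacement (?m w)) (length xs) (length zs)"
      "int (length (?m w)) = \<bar>displacement (?m w)\<bar> + 2 * (int (length xs) + int (length zs))"
      using right_tour_extent[of "?m xs" "?m ys" "?m zs"] switching_turns_mirror[of w] turns dirs len False
      by (auto simp: w image_subset_iff simp del: lit_append displacement_append)
    then have "lamp_extent (lit 0 w) (displacement w) (length zs) (length xs)"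
      "int (length w) = \<bar>displacement w\<bar> + 2 * (int (length zs) + int (length xs))"
      using lamp_extent_mirror[of "lit 0 w" "displacement w"]
      by (simp_all add: displacement_mirror lit_mirror[of 0, abs_def] add.commute)
    then show ?thesis by blast
  qed
qed

lemma tour_length_unique:
  assumes "u \<in> tours" "v \<in> tours" "lamp_equiv u v"
  shows "length u = length v"
  using tour_extent[OF assms(1)] tour_extent[OF assms(2)] assms(3) lamp_extent_unique
  unfolding lamp_equiv_def by (metis of_nat_eq_iff)

text \<open>A geodesic cannot be shortened, so it is a tour. Conversely, a shortest word equivalent
  to a tour is itself a tour, hence of the same length.\<close>

lemma geodesics_eq_tours: "geodesics L\<^sub>2 lamp_gens = map move_elem ` tours"
proof -
  have "(\<forall>v. lamp_equiv w v \<longrightarrow> length w \<le> length v) \<longleftrightarrow> w \<in> tours" for w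
  proof
    assume "\<forall>v. lamp_equiv w v \<longrightarrow> length w \<le> length v"
    then show "w \<in> tours" using shorten_non_tour by (meson not_less)
  next
    assume w: "w \<in> tours"
    obtain u where u: "lamp_equiv w u" "\<And>v. lamp_equiv w v \<Longrightarrow> length u \<le> length v"
      using ex_has_least_nat[of "lamp_equiv w" w length] by auto
    then have "lamp_equiv w v" if "lamp_equiv u v" for v
      using that by (simp add: lamp_equiv_def)
    with u have "u \<in> tours" using shorten_non_tour by (meson not_less)
    with w u show "\<forall>v. lamp_equiv w v \<longrightarrow> length w \<le> length v"
      using tour_length_unique by metis
  qed
  then have "map move_elem w \<in> geodesics L\<^sub>2 lamp_gens \<longleftrightarrow> w \<in> tours" for w
    unfolding map_move_elem_geodesic_iff .
  moreover have "geodesics L\<^sub>2 lamp_gens \<subseteq> range (map move_elem)"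
    by (auto simp: geodesics_def letters_lamp_gens lists_image)
  ultimately show ?thesis by blast
qed

section \<open>The automaton\<close>

text \<open>The argument \<open>h\<close> is the sum of the counter changes along the rest of the
  run, not the value reached so far.\<close>

fun counter_run :: "('v \<times> 'b \<times> int \<times> 'v) set \<Rightarrow> 'v set \<Rightarrow> 'v \<Rightarrow> 'b list \<Rightarrow> int \<Rightarrow> bool" where
  "counter_run D F p [] h \<longleftrightarrow> p \<in> F \<and> h = 0"
| "counter_run D F p (x # w) h \<longleftrightarrow> (\<exists>c q. (p, x, c, q) \<in> D \<and> counter_run D F q w (h - c))"

text \<open>States are encoded by \<open>to_nat\<close> and letters translated by \<sigma>; runs and
  paths then correspond edge by edge, each edge reading one letter.\<close>

lemma accepted_by_one_counterI:
  fixes D :: "('v::countable \<times> 'b \<times> int \<times> 'v) set" and \<sigma> :: "'b \<Rightarrow> 'a"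
  assumes "finite D" "finite F" "finite A" and \<sigma>: "range \<sigma> \<subseteq> A"
  shows "accepted_by_one_counter A (map \<sigma> ` {w. counter_run D F s w 0})"
proof -
  \<comment> \<open>Adding the start, the accepting states and all ends of edges gives a finite
    vertex set even if the type of states is infinite.\<close>
  define V where "V = insert s (F \<union> fst ` D \<union> (\<lambda>(p, x, c, q). q) ` D)"
  define M :: "(nat, 'a, int) automaton" where
    "M = \<lparr>vertices = to_nat ` V,
          edges = (\<lambda>(p, x, c, q). (to_nat p, Some (\<sigma> x), c, to_nat q)) ` D,
          start = to_nat s, accepting = to_nat ` F\<rparr>"
  have target: "q \<in> V" if "(p, x, c, q) \<in> D" for p x c q
    using that unfolding V_def by force
  have source: "p \<in> V" if "(p, x, c, q) \<in> D" for p x c q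
    using that unfolding V_def by force
  have F: "F \<subseteq> V" and s: "s \<in> V"
    by (auto simp: V_def)
  have "finite V"
    using assms by (simp add: V_def)
  then have "group_automaton integer_group A M"
    using assms F s by (auto simp: group_automaton_def M_def target source)
  moreover have "\<exists>w. counter_run D F p w (path_value integer_group es) \<and> path_word es = map \<sigma> w"
    if "is_path M (to_nat p) es (to_nat q)" "q \<in> F" for p es q
    using that(1)
  proof (induction es arbitrary: p)
    case Nil
    then show ?case
      using \<open>q \<in> F\<close> by (intro exI[of _ "[]"]) (simp add: path_value_def path_word_def)
  next
    case (Cons e es)
    then obtain x c p' where e: "(p, x, c, p') \<in> D" "e = (to_nat p, Some (\<sigma> x), c, to_nat p')"
      "is_path M (to_nat p') es (to_nat q)"
      by (auto simp: M_def)
    from Cons.IH[OF e(3)] obtain w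
      where "counter_run D F p' w (path_value integer_group es)" "path_word es = map \<sigma> w" by blast
    with e show ?case
      by (intro exI[of _ "x # w"]) (auto simp: path_value_def path_word_def intro!: exI[of _ c] exI[of _ p'])
  qed
  moreover have "\<exists>es. \<exists>q\<in>F. is_path M (to_nat p) es (to_nat q) \<and> path_word es = map \<sigma> w \<and>
      path_value integer_group es = h"
    if "counter_run D F p w h" "p \<in> V" for p w h
    using that
  proof (induction w arbitrary: p h)
    case Nil
    then show ?case
      by (intro exI[of _ "[]"]) (auto simp: path_value_def path_word_def M_def)
  next
    case (Cons x w)
    then obtain c p' where c: "(p, x, c, p') \<in> D" "counter_run D F p' w (h - c)"
      by auto
    from Cons.IH[OF c(2) target[OF c(1)]] obtain es q where "q \<in> F"
      "is_path M (to_nat p') es (to_nat q)" "path_word es = map \<sigma> w"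
      "path_value integer_group es = h - c" by blast
    moreover have "(to_nat p, Some (\<sigma> x), c, to_nat p') \<in> edges M"
      using c(1) by (force simp: M_def)
    ultimately show ?case
      by (intro exI[of _ "(to_nat p, Some (\<sigma> x), c, to_nat p') # es"] bexI[of _ q])
        (auto simp: path_value_def path_word_def)
  qed
  ultimately have "accepted_language integer_group M = map \<sigma> ` {w. counter_run D F s w 0}"
    using s by (fastforce simp: accepted_language_def M_def)
  with \<open>group_automaton integer_group A M\<close> show ?thesis
    unfolding accepted_by_one_counter_def by blast
qed

text \<open>A state \<open>Some (d, k, x)\<close> records the guessed direction of the middle part of the tour, the
  index of the current part and the last move. A move of the middle part may or may not decrease
  the counter, so that a run can end at counter value zero iff the outer parts together are not
  longer than the middle part.\<close>

definition tour_edges ::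
    "((bool \<times> nat \<times> move) option \<times> move \<times> int \<times> (bool \<times> nat \<times> move) option) set" where
  "tour_edges = {(p, y, c, q). \<exists>d k. q = Some (d, k, y) \<and> k \<le> 2 \<and> fst y = (d = (k = 1)) \<and>
     c \<in> (if k = 1 then {0, - 1} else {1}) \<and>
     (case p of None \<Rightarrow> True
      | Some (d', j, x) \<Rightarrow> d' = d \<and> j \<le> k \<and> (fst x \<noteq> fst y \<longrightarrow> snd x \<noteq> snd y))}"

text \<open>Used as the accepting set as well: every state accepts, so only the edges and the final
  counter value restrict the words.\<close>

definition tour_states :: "(bool \<times> nat \<times> move) option set" where
  "tour_states = insert None (Some ` (UNIV \<times> {..2} \<times> UNIV))"

lemma finite_tour_states: "finite tour_states"
  by (simp add: tour_states_def)

lemma finite_tour_edges: "finite tour_edges"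
proof (rule finite_subset)
  show "tour_edges \<subseteq> tour_states \<times> UNIV \<times> {- 1, 0, 1} \<times> tour_states"
  proof
    fix e
    assume "e \<in> tour_edges"
    then obtain p y c q d k where e: "e = (p, y, c, q)" and "q = Some (d, k, y)" "k \<le> 2"
      and c: "c \<in> (if k = 1 then {0, - 1} else {1})"
      and "case p of None \<Rightarrow> True
        | Some (d', j, x) \<Rightarrow> d' = d \<and> j \<le> k \<and> (fst x \<noteq> fst y \<longrightarrow> snd x \<noteq> snd y)"
      unfolding tour_edges_def mem_Collect_eq prod.case by blast
    then have "p \<in> tour_states" "q \<in> tour_states"
      by (cases p; force simp: tour_states_def)+
    moreover have "c \<in> {- 1, 0, 1}"
      using c by (auto split: if_splits)
    ultimately show "e \<in> tour_states \<times> UNIV \<times> {- 1, 0, 1} \<times> tour_states"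
      by (simp add: e)
  qed
qed (simp add: finite_tour_states)

text \<open>What can still be read in part \<open>k\<close> with total counter change
  \<open>h\<close>: each outer move adds 1 and each middle move adds 0 or -1, so the possible totals
  fill the stated interval.\<close>

definition tour_suffix :: "bool \<Rightarrow> nat \<Rightarrow> move list \<Rightarrow> int \<Rightarrow> bool" where
  "tour_suffix d k w h \<longleftrightarrow> (\<exists>xs ys zs. w = xs @ ys @ zs \<and> (k > 0 \<longrightarrow> xs = []) \<and> (k > 1 \<longrightarrow> ys = []) \<and>
     fst ` set xs \<subseteq> {\<not> d} \<and> fst ` set ys \<subseteq> {d} \<and> fst ` set zs \<subseteq> {\<not> d} \<and>
     int (length xs) + int (length zs) - int (length ys) \<le> h \<and> h \<le> int (length xs) + int (length zs))"

lemma tour_suffixI: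
  assumes "k > 0 \<Longrightarrow> xs = []" "k > 1 \<Longrightarrow> ys = []"
    "fst ` set xs \<subseteq> {\<not> d}" "fst ` set ys \<subseteq> {d}" "fst ` set zs \<subseteq> {\<not> d}"
    "int (length xs) + int (length zs) - int (length ys) \<le> h" "h \<le> int (length xs) + int (length zs)"
  shows "tour_suffix d k (xs @ ys @ zs) h"
  using assms unfolding tour_suffix_def by blast

lemma tour_suffixE:
  assumes "tour_suffix d k w h"
  obtains xs ys zs where "w = xs @ ys @ zs" "k > 0 \<longrightarrow> xs = []" "k > 1 \<longrightarrow> ys = []"
    "fst ` set xs \<subseteq> {\<not> d}" "fst ` set ys \<subseteq> {d}" "fst ` set zs \<subseteq> {\<not> d}"
    "int (length xs) + int (length zs) - int (length ys) \<le> h" "h \<le> int (length xs) + int (length zs)"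
  using assms unfolding tour_suffix_def by (elim conjE exE) (rule that)

lemma tour_suffix_Nil: "tour_suffix d k [] h \<longleftrightarrow> h = 0"
  using tour_suffixI[of k "[]" "[]" d "[]" h] by (auto elim: tour_suffixE)

text \<open>The recursion mirrors one edge of the automaton: \<open>k\<close> is the index of the
  part that contains \<open>y\<close>, and \<open>c\<close> is the counter change of
  \<open>y\<close>.\<close>

lemma tour_suffix_Cons:
  assumes "j \<le> 2"
  shows "tour_suffix d j (y # w) h \<longleftrightarrow>
    (\<exists>k c. j \<le> k \<and> k \<le> 2 \<and> fst y = (d = (k = 1)) \<and> c \<in> (if k = 1 then {0, - 1} else {1}) \<and>
      tour_suffix d k w (h - c))" (is "?L \<longleftrightarrow> ?R")
proof
  assume ?L
  then obtain xs ys zs where w: "y # w = xs @ ys @ zs"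
    and parts: "j > 0 \<longrightarrow> xs = []" "j > 1 \<longrightarrow> ys = []"
    and dirs: "fst ` set xs \<subseteq> {\<not> d}" "fst ` set ys \<subseteq> {d}" "fst ` set zs \<subseteq> {\<not> d}"
    and h: "int (length xs) + int (length zs) - int (length ys) \<le> h"
      "h \<le> int (length xs) + int (length zs)"
    by (rule tour_suffixE)
  consider xs' where "xs = y # xs'" "w = xs' @ ys @ zs"
    | ys' where "xs = []" "ys = y # ys'" "w = ys' @ zs"
    | zs' where "xs = []" "ys = []" "zs = y # zs'" "w = zs'"
    using w by (cases xs; cases ys) auto
  then show ?R
  proof cases
    case 1
    then have "tour_suffix d 0 w (h - 1)"
      using dirs h by (auto intro!: tour_suffixI)
    then show ?thesis
      using 1 parts dirs by (intro exI[of _ 0] exI[of _ 1]) auto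
  next
    case 2
    \<comment> \<open>At the lower end of the interval every middle move has to decrease the
      counter; above it this move can leave the counter unchanged.\<close>
    define c :: int where "c = (if int (length zs) - int (length ys) = h then - 1 else 0)"
    have "tour_suffix d 1 ([] @ ys' @ zs) (h - c)"
      using dirs h 2 by (intro tour_suffixI) (auto simp: c_def)
    then show ?thesis
      using 2 parts dirs by (intro exI[of _ 1] exI[of _ c]) (auto simp: c_def not_less)
  next
    case 3
    then have "tour_suffix d 2 ([] @ [] @ zs') (h - 1)"
      using dirs h by (intro tour_suffixI) auto
    then show ?thesis
      using 3 dirs assms by (intro exI[of _ 2] exI[of _ 1]) auto
  qed
next
  assume ?R
  then obtain k c where jk: "j \<le> k" "k \<le> 2" and y: "fst y = (d = (k = 1))"
    and c: "c \<in> (if k = 1 then {0, - 1} else {1})" and "tour_suffix d k w (h - c)"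
    by blast
  from this(5) obtain xs ys zs where w: "w = xs @ ys @ zs"
    and parts: "k > 0 \<longrightarrow> xs = []" "k > 1 \<longrightarrow> ys = []"
    and dirs: "fst ` set xs \<subseteq> {\<not> d}" "fst ` set ys \<subseteq> {d}" "fst ` set zs \<subseteq> {\<not> d}"
    and h: "int (length xs) + int (length zs) - int (length ys) \<le> h - c"
      "h - c \<le> int (length xs) + int (length zs)"
    by (rule tour_suffixE)
  from jk consider "k = 0" | "k = 1" | "k = 2" by linarith
  then show ?L
  proof cases
    case 1
    then have "tour_suffix d j ((y # xs) @ ys @ zs) h"
      using jk y c dirs h by (intro tour_suffixI) auto
    then show ?thesis by (simp add: w)
  next
    case 2
    then have "tour_suffix d j ([] @ (y # ys) @ zs) h"
      using jk y c dirs h parts by (intro tour_suffixI) auto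
    then show ?thesis using 2 parts by (simp add: w)
  next
    case 3
    then have "tour_suffix d j ([] @ [] @ (y # zs)) h"
      using jk y c dirs h parts by (intro tour_suffixI) auto
    then show ?thesis using 3 parts by (simp add: w)
  qed
qed

section \<open>Runs of the tour automaton\<close>

lemma switching_turns_Cons_Cons:
  "switching_turns (x # y # w) \<longleftrightarrow> (fst x \<noteq> fst y \<longrightarrow> snd x \<noteq> snd y) \<and> switching_turns (y # w)"
  by (simp add: switching_turns_def)

text \<open>The state remembers the last move \<open>x\<close>, so each edge checks the turn between
  \<open>x\<close> and the next move; the rest of the edge condition is the recursion of
  \<open>tour_suffix\<close>.\<close>

lemma counter_run_tour_suffix:
  assumes "j \<le> 2"
  shows "counter_run tour_edges tour_states (Some (d, j, x)) w h \<longleftrightarrow>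
    switching_turns (x # w) \<and> tour_suffix d j w h"
  using assms
proof (induction w arbitrary: j x h)
  case Nil
  then show ?case
    by (auto simp: tour_suffix_Nil tour_states_def switching_turns_def)
next
  case (Cons y w)
  have "counter_run tour_edges tour_states (Some (d, j, x)) (y # w) h \<longleftrightarrow>
      (\<exists>k c. j \<le> k \<and> k \<le> 2 \<and> fst y = (d = (k = 1)) \<and> c \<in> (if k = 1 then {0, - 1} else {1}) \<and>
        (fst x \<noteq> fst y \<longrightarrow> snd x \<noteq> snd y) \<and>
        counter_run tour_edges tour_states (Some (d, k, y)) w (h - c))"
    by (auto simp: tour_edges_def simp del: split_paired_Ex)
  also have "\<dots> \<longleftrightarrow> switching_turns (x # y # w) \<and> tour_suffix d j (y # w) h"
    unfolding tour_suffix_Cons[OF Cons.prems] switching_turns_Cons_Cons using Cons.IH by blast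
  finally show ?case .
qed

lemma counter_run_tour_iff: "counter_run tour_edges tour_states None w 0 \<longleftrightarrow> w \<in> tours"
proof -
  have "counter_run tour_edges tour_states None w 0 \<longleftrightarrow>
      switching_turns w \<and> (\<exists>d. tour_suffix d 0 w 0)"
  proof (cases w)
    case Nil
    then show ?thesis
      by (simp add: tour_suffix_Nil tour_states_def switching_turns_def)
  next
    case (Cons y w')
    have "counter_run tour_edges tour_states None (y # w') 0 \<longleftrightarrow>
        (\<exists>d k c. k \<le> 2 \<and> fst y = (d = (k = 1)) \<and> c \<in> (if k = 1 then {0, - 1} else {1}) \<and>
          counter_run tour_edges tour_states (Some (d, k, y)) w' (0 - c))"
      by (auto simp: tour_edges_def simp del: split_paired_Ex)
    also have "\<dots> \<longleftrightarrow> switching_turns (y # w') \<and> (\<exists>d. tour_suffix d 0 (y # w') 0)"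
      by (simp add: tour_suffix_Cons counter_run_tour_suffix cong: conj_cong) blast
    finally show ?thesis by (simp add: Cons)
  qed
  \<comment> \<open>For \<open>h = 0\<close> the upper bound of the interval is trivial and the
    lower one is the length condition of \<open>tours\<close>.\<close>
  also have "\<dots> \<longleftrightarrow> w \<in> tours"
    by (auto simp: tours_def tour_suffix_def simp flip: of_nat_add)
  finally show ?thesis .
qed

theorem theorem25:
  shows "accepted_by_one_counter (letters L\<^sub>2 lamp_gens) (geodesics L\<^sub>2 lamp_gens)"
  using accepted_by_one_counterI[OF finite_tour_edges finite_tour_states, of _ move_elem None]
  by (simp add: geodesics_eq_tours letters_lamp_gens counter_run_tour_iff)

end
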